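(* Let $G \cong \mathbb{R}^{d_1}\times\mathbb{R}^{d_2}$ be a 2-step stratified group with sub-Laplacian $\mathcal{L}$, and let $\mathcal{H}(\mathbf{x},\boldsymbol{\xi}) \mathrel{:=} |\xi + J_\mu x/2|$ for $\mathbf{x}=(x,u)$, $\boldsymbol{\xi}=(\xi,\mu)\in\mathbb{R}^{d_1}\times\mathbb{R}^{d_2}$. Let $\boldsymbol{\xi}_0=(\xi_0,\mu_0)\in\mathbb{R}^d$. (i) The solution $(\mathbf{x}(t),\boldsymbol{\xi}(t))$ of $\dot{\mathbf{x}} = \nabla_{\boldsymbol{\xi}}\mathcal{A}$, $\dot{\boldsymbol{\xi}} = -\nabla_{\mathbf{x}}\mathcal{A}$, $\mathbf{x}(0)=0$, $\boldsymbol{\xi}(0)=\boldsymbol{\xi}_0$, with $\mathcal{A} \mathrel{:=} \mathcal{H}^2/2$, is \[ x(t) = \frac{\exp(tJ_{\mu_0})-I}{J_{\mu_0}}\xi_0,\quad \xi(t)=\tfrac12(I+\exp(tJ_{\mu_0}))\xi_0,\quad u(t)=\tfrac12\int_0^t\Big[\frac{\exp(\tau J_{\mu_0})-I}{J_{\mu_0}}\xi_0,\exp(\tau J_{\mu_0})\xi_0\Big]d\tau,\quad \mu(t)=\mu_0. \] (ii) If $\xi_0\neq 0$, the solution of $\dot{\mathbf{x}} = \nabla_{\boldsymbol{\xi}}\mathcal{H}$, $\dot{\boldsymbol{\xi}} = -\nabla_{\mathbf{x}}\mathcal{H}$, $\mathbf{x}(0)=0$, $\boldsymbol{\xi}(0)=\boldsymbol{\xi}_0$,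 is \[ x(t) = \frac{\exp(tJ_{\mu_0/|\xi_0|})-I}{J_{\mu_0}}\xi_0,\quad \xi(t)=\tfrac12(I+\exp(tJ_{\mu_0/|\xi_0|}))\xi_0, \] \[ u(t)=\tfrac12\int_0^t\Big[\frac{\exp(\tau J_{\mu_0/|\xi_0|})-I}{J_{\mu_0}}\xi_0,\exp(\tau J_{\mu_0/|\xi_0|})\frac{\xi_0}{|\xi_0|}\Big]d\tau,\quad \mu(t)=\mu_0. \]
   Context: $G$ is a 2-step stratified Lie group identified with $\mathbb{R}^{d_1}_x\times\mathbb{R}^{d_2}_u$ via exponential coordinates, with coordinates on $\mathfrak{g}_1$ orthonormal for the inner product $\langle\cdot,\cdot\rangle$ making the vector fields $X_j$ of $\mathcal{L}=-\sum X_j^2$ orthonormal; $[\cdot,\cdot]:\mathbb{R}^{d_1}\times\mathbb{R}^{d_1}\to\mathbb{R}^{d_2}$ is the Lie bracket in these coordinates. For $\mu\in\mathbb{R}^{d_2}$, $J_\mu$ is the skew-symmetric $d_1\times d_1$ matrix with $\langle J_\mu x,x'\rangle=\mu\cdot[x,x']$. Expressions of the form $\frac{\exp(sJ)-I}{J}$ denote $f(J)$ for the entire function $f(z)=(e^{sz}-1)/z$, i.e. $\sum_{n\geq1}s^nJ^{n-1}/n!$ (so no invertibility of $J$ is needed). *)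

theory Defs
  imports "HOL-Analysis.Analysis"
begin

text \<open>Matrix powers (matrix product).\<close>
primrec mpow :: "real^'n^'n \<Rightarrow> nat \<Rightarrow> real^'n^'n" where
  "mpow A 0 = mat 1"
| "mpow A (Suc k) = A ** mpow A k"

text \<open>Matrix exponential exp(sA) as its power series.\<close>
definition mexp :: "real \<Rightarrow> real^'n^'n \<Rightarrow> real^'n^'n" where
  "mexp s A = (\<Sum>k. (s ^ k / fact k) *\<^sub>R mpow A k)"

text \<open>(exp(sA) - I)/A, i.e. f(A) for the entire function f(z) = (e^{sz}-1)/z,
  given by the series sum over n >= 1 of s^n A^(n-1)/n!.\<close>
definition mphi :: "real \<Rightarrow> real^'n^'n \<Rightarrow> real^'n^'n" where
  "mphi s A = (\<Sum>k. (s ^ Suc k / fact (Suc k)) *\<^sub>R mpow A k)"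

text \<open>J_mu: the matrix with <J_mu x, x'> = mu . [x, x'] (entries J_ij = mu . [e_j, e_i]).\<close>
definition Jmat :: "(real^'n \<Rightarrow> real^'n \<Rightarrow> real^'m) \<Rightarrow> real^'m \<Rightarrow> real^'n^'n" where
  "Jmat br \<mu> = (\<chi> i j. \<mu> \<bullet> br (axis j 1) (axis i 1))"

text \<open>H(x, xi) = |xi + J_mu x / 2| for x = (x,u), xi = (xi,mu).\<close>
definition Hsub :: "(real^'n \<Rightarrow> real^'n \<Rightarrow> real^'m) \<Rightarrow> ((real^'n) \<times> (real^'m)) \<Rightarrow> ((real^'n) \<times> (real^'m)) \<Rightarrow> real" where
  "Hsub br X \<Xi> = norm (fst \<Xi> + (1/2) *\<^sub>R (Jmat br (snd \<Xi>) *v fst X))"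

text \<open>g is the gradient of f at x.\<close>
definition has_gradient :: "('a::real_inner \<Rightarrow> real) \<Rightarrow> 'a \<Rightarrow> 'a \<Rightarrow> bool" where
  "has_gradient f g x \<longleftrightarrow> (f has_derivative (\<lambda>h. g \<bullet> h)) (at x)"

text \<open>(X, Xi) solves dX/dt = grad_xi Ham, dXi/dt = - grad_x Ham for all real t,
  with X(0) = X0, Xi(0) = Xi0.\<close>
definition hamiltonian_solution ::
  "('p::real_inner \<Rightarrow> 'p \<Rightarrow> real) \<Rightarrow> (real \<Rightarrow> 'p) \<Rightarrow> (real \<Rightarrow> 'p) \<Rightarrow> 'p \<Rightarrow> 'p \<Rightarrow> bool" where
  "hamiltonian_solution Ham X \<Xi> X0 \<Xi>0 \<longleftrightarrow>
     X 0 = X0 \<and> \<Xi> 0 = \<Xi>0 \<and>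
     (\<forall>t. \<exists>X' \<Xi>'. (X has_vector_derivative X') (at t) \<and> (\<Xi> has_vector_derivative \<Xi>') (at t) \<and>
        has_gradient (\<lambda>\<eta>. Ham (X t) \<eta>) X' (\<Xi> t) \<and>
        has_gradient (\<lambda>y. Ham y (\<Xi> t)) (- \<Xi>') (X t))"

text \<open>Oriented integral from 0 to t.\<close>
definition oint :: "real \<Rightarrow> (real \<Rightarrow> 'a::euclidean_space) \<Rightarrow> 'a" where
  "oint t f = (if 0 \<le> t then integral {0..t} f else - integral {t..0} f)"

end

theory Submission
  imports Defs
begin

text \<open>Both Hamiltonians are functions \<open>g(v)\<close> of the horizontal momentum
  \<open>v = \<xi> + J\<^sub>\<mu> x / 2\<close>. For such a Hamiltonian, Hamilton's equations say that \<open>\<mu>\<close>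
  is constant and \<open>x' = \<nabla>g(v)\<close>, \<open>u' = [x, \<nabla>g(v)] / 2\<close>, \<open>\<xi>' = J\<^sub>\<mu> \<nabla>g(v) / 2\<close>,
  hence \<open>v' = J\<^sub>\<mu> \<nabla>g(v)\<close>. Along solutions \<open>\<nabla>g(v) = v / c\<close>, with \<open>c = 1\<close> for
  \<open>|v|\<^sup>2 / 2\<close> and \<open>c = |\<xi>\<^sub>0|\<close> for \<open>|v|\<close>: in the second case \<open>|v|\<close> is conserved
  because \<open>J\<^sub>\<mu>\<close> is skew, and \<open>v\<close> never vanishes because the norm is not differentiable
  at \<open>0\<close>. So \<open>v(t) = exp(t J\<^sub>\<mu> / c) \<xi>\<^sub>0\<close>, and \<open>x\<close>, \<open>u\<close>, \<open>\<xi>\<close> follow by integration.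
  Uniqueness holds because the difference of two solutions of the linear equation
  \<open>v' = J\<^sub>\<mu> v / c\<close> has constant norm.\<close>

subsection \<open>Power series of matrices\<close>

lemma summable_norm_exp_series:
  fixes M :: "nat \<Rightarrow> 'a::real_normed_vector"
  assumes bound: "\<And>k. norm (M k) \<le> K * C ^ k"
  shows "summable (\<lambda>k. norm ((s ^ k / fact k) *\<^sub>R M k))"
proof (rule summable_comparison_test')
  show "summable (\<lambda>k. K * (inverse (fact k) * (\<bar>s\<bar> * C) ^ k))"
    by (intro summable_mult summable_exp)
  fix k :: nat
  have "norm ((s ^ k / fact k) *\<^sub>R M k) = (\<bar>s\<bar> ^ k / fact k) * norm (M k)"
    by (simp add: power_abs)
  also have "\<dots> \<le> (\<bar>s\<bar> ^ k / fact k) * (K * C ^ k)"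
    by (intro mult_left_mono bound) auto
  also have "\<dots> = K * (inverse (fact k) * (\<bar>s\<bar> * C) ^ k)"
    by (simp add: power_mult_distrib field_simps)
  finally show "norm (norm ((s ^ k / fact k) *\<^sub>R M k)) \<le> K * (inverse (fact k) * (\<bar>s\<bar> * C) ^ k)"
    by simp
qed

lemma has_vector_derivative_exp_series:
  fixes M :: "nat \<Rightarrow> 'a::euclidean_space"
  assumes bound: "\<And>k. norm (M k) \<le> K * C ^ k"
  shows "((\<lambda>s. \<Sum>k. (s ^ k / fact k) *\<^sub>R M k) has_vector_derivative
           (\<Sum>k. (t ^ k / fact k) *\<^sub>R M (Suc k))) (at t)"
proof -
  have bound_Suc: "norm (M (Suc k)) \<le> (K * C) * C ^ k" for k
    using bound[of "Suc k"] by (simp add: mult.assoc)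
  have inner_suminf: "(\<Sum>k. (s ^ k / fact k) *\<^sub>R N k) \<bullet> b = (\<Sum>k. (N k \<bullet> b / fact k) * s ^ k)"
    if "\<And>k. norm (N k) \<le> L * C ^ k" for N :: "nat \<Rightarrow> 'a" and L s b
    using bounded_linear.suminf[OF bounded_linear_inner_left
        summable_norm_cancel[OF summable_norm_exp_series[OF that]]]
    by (simp add: mult.commute)
  have summable_component: "summable (\<lambda>k. (M k \<bullet> b / fact k) * y ^ k)" if "b \<in> Basis" for b y
  proof (rule summable_comparison_test'[OF summable_norm_exp_series[OF bound, of y]])
    fix k
    have "\<bar>M k \<bullet> b\<bar> \<le> norm (M k)"
      using that by (rule Basis_le_norm)
    then show "norm ((M k \<bullet> b / fact k) * y ^ k) \<le> norm ((y ^ k / fact k) *\<^sub>R M k)"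
      by (auto simp: abs_mult power_abs divide_simps mult.commute[of _ "\<bar>y\<bar> ^ k"]
          intro!: mult_left_mono)
  qed
  show ?thesis
    unfolding has_vector_derivative_def
  proof (subst has_derivative_componentwise_within, intro ballI)
    fix b :: 'a
    assume b: "b \<in> Basis"
    have "((\<lambda>s. \<Sum>k. (M k \<bullet> b / fact k) * s ^ k) has_field_derivative
             (\<Sum>k. diffs (\<lambda>k. M k \<bullet> b / fact k) k * t ^ k)) (at t)"
      by (rule termdiffs_strong_converges_everywhere[OF summable_component[OF b]])
    moreover have "(\<Sum>k. diffs (\<lambda>k. M k \<bullet> b / fact k) k * t ^ k) =
        (\<Sum>k. (t ^ k / fact k) *\<^sub>R M (Suc k)) \<bullet> b"
      unfolding inner_suminf[OF bound_Suc] diffs_def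
      by (intro suminf_cong) (simp add: field_simps fact_Suc del: of_nat_Suc)
    ultimately show "((\<lambda>s. (\<Sum>k. (s ^ k / fact k) *\<^sub>R M k) \<bullet> b) has_derivative
        (\<lambda>h. (h *\<^sub>R (\<Sum>k. (t ^ k / fact k) *\<^sub>R M (Suc k))) \<bullet> b)) (at t)"
      unfolding inner_suminf[OF bound]
      by (simp add: has_field_derivative_def
          mult.commute[of _ "(\<Sum>k. (t ^ k / fact k) *\<^sub>R M (Suc k)) \<bullet> b"])
  qed
qed

lemma bounded_linear_matrix_mult_left: "bounded_linear (\<lambda>X::real^'k^'n. (A::real^'n^'m) ** X)"
  unfolding linear_conv_bounded_linear[symmetric]
  by (rule linearI) (auto simp: matrix_add_ldistrib matrix_scalar_ac scalar_matrix_assoc)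

lemma bounded_linear_matrix_vector_mult_left: "bounded_linear (\<lambda>A::real^'n^'m. A *v x)"
  unfolding linear_conv_bounded_linear[symmetric]
  by (rule linearI) (auto simp: matrix_vector_mult_add_rdistrib scaleR_matrix_vector_assoc)

lemma onorm_matrix_mult_le:
  "onorm ((*v) (A ** B)) \<le> onorm ((*v) (A::real^'n^'m)) * onorm ((*v) (B::real^'k^'n))"
proof -
  have "(*v) (A ** B) = (*v) A \<circ> (*v) B"
    by (auto simp: matrix_vector_mul_assoc)
  then show ?thesis
    using onorm_compose[of "(*v) A" "(*v) B"] by simp
qed

lemma onorm_mpow_le: "onorm ((*v) (mpow A k)) \<le> onorm ((*v) (A::real^'n^'n)) ^ k"
proof (induction k)
  case 0
  have "(*v) (mat 1 :: real^'n^'n) = id"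
    by auto
  then show ?case
    using onorm_id_le by simp
next
  case (Suc k)
  have "onorm ((*v) (mpow A (Suc k))) \<le> onorm ((*v) A) * onorm ((*v) (mpow A k))"
    using onorm_matrix_mult_le by simp
  also have "\<dots> \<le> onorm ((*v) A) * onorm ((*v) A) ^ k"
    by (intro mult_left_mono Suc onorm_pos_le) auto
  finally show ?case
    by simp
qed

lemma norm_le_card_onorm: "norm (A::real^'n^'m) \<le> real CARD('m) * real CARD('n) * onorm ((*v) A)"
proof -
  have "norm A \<le> (\<Sum>i\<in>UNIV. norm (A $ i))"
    unfolding norm_vec_def by (rule L2_set_le_sum) auto
  also have "\<dots> \<le> (\<Sum>i\<in>(UNIV::'m set). \<Sum>j\<in>(UNIV::'n set). onorm ((*v) A))"
    by (intro sum_mono order_trans[OF norm_le_l1_cart] matrix_component_le_onorm)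
  finally show ?thesis
    by simp
qed

lemma norm_mpow_le: "norm (mpow A k) \<le> (real CARD('n) * real CARD('n)) * onorm ((*v) (A::real^'n^'n)) ^ k"
  by (rule order_trans[OF norm_le_card_onorm]) (intro mult_left_mono onorm_mpow_le, simp)

lemma summable_mexp_series: "summable (\<lambda>k. (s ^ k / fact k) *\<^sub>R mpow (A::real^'n^'n) k)"
  by (rule summable_norm_cancel[OF summable_norm_exp_series[OF norm_mpow_le]])

lemma has_vector_derivative_mexp: "((\<lambda>s. mexp s A) has_vector_derivative A ** mexp t A) (at t)"
proof -
  have "A ** mexp t A = (\<Sum>k. A ** ((t ^ k / fact k) *\<^sub>R mpow A k))"
    unfolding mexp_def
    using bounded_linear.suminf[OF bounded_linear_matrix_mult_left[of A] summable_mexp_series[of t A]]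
    by simp
  also have "\<dots> = (\<Sum>k. (t ^ k / fact k) *\<^sub>R mpow A (Suc k))"
    by (simp add: matrix_scalar_ac scalar_matrix_assoc)
  finally show ?thesis
    unfolding mexp_def using has_vector_derivative_exp_series[OF norm_mpow_le] by simp
qed

text \<open>\<open>mphi s A\<close> is the exponential series of the shifted sequence \<open>0, I, A, A\<^sup>2, \<dots>\<close>.\<close>

lemma norm_shifted_mpow_le:
  "norm (case k of 0 \<Rightarrow> 0 | Suc j \<Rightarrow> mpow A j)
     \<le> (real CARD('n) * real CARD('n)) * (onorm ((*v) (A::real^'n^'n)) + 1) ^ k"
proof (cases k)
  case (Suc j)
  have "norm (mpow A j) \<le> (real CARD('n) * real CARD('n)) * onorm ((*v) A) ^ j"
    by (rule norm_mpow_le)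
  also have "\<dots> \<le> (real CARD('n) * real CARD('n)) * (onorm ((*v) A) + 1) ^ Suc j"
    using onorm_pos_le[OF matrix_vector_mul_bounded_linear, of A]
    by (intro mult_left_mono order_trans[OF power_mono power_increasing]) auto
  finally show ?thesis
    by (simp add: Suc)
qed simp

lemma mphi_eq_exp_series:
  "mphi s A = (\<Sum>k. (s ^ k / fact k) *\<^sub>R (case k of 0 \<Rightarrow> 0 | Suc j \<Rightarrow> mpow (A::real^'n^'n) j))"
  unfolding mphi_def
  using suminf_split_head[OF summable_norm_cancel[OF summable_norm_exp_series[OF norm_shifted_mpow_le]]]
  by simp

lemma has_vector_derivative_mphi: "((\<lambda>s. mphi s A) has_vector_derivative mexp t (A::real^'n^'n)) (at t)"
  unfolding mphi_eq_exp_series mexp_def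
  using has_vector_derivative_exp_series[OF norm_shifted_mpow_le] by simp

lemma matrix_mult_mphi: "A ** mphi s A = mexp s A - mat 1"
proof -
  have summable: "summable (\<lambda>k. (s ^ Suc k / fact (Suc k)) *\<^sub>R mpow A k)"
    using summable_Suc_iff[of "\<lambda>k. (s ^ k / fact k) *\<^sub>R (case k of 0 \<Rightarrow> 0 | Suc j \<Rightarrow> mpow A j)"]
      summable_norm_cancel[OF summable_norm_exp_series[OF norm_shifted_mpow_le]]
    by simp
  have "A ** mphi s A = (\<Sum>k. A ** ((s ^ Suc k / fact (Suc k)) *\<^sub>R mpow A k))"
    unfolding mphi_def using bounded_linear.suminf[OF bounded_linear_matrix_mult_left summable] by simp
  also have "\<dots> = (\<Sum>k. (s ^ Suc k / fact (Suc k)) *\<^sub>R mpow A (Suc k))"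
    by (simp add: matrix_scalar_ac scalar_matrix_assoc)
  also have "\<dots> = mexp s A - mat 1"
    unfolding mexp_def using suminf_split_head[OF summable_mexp_series[of s A]] by simp
  finally show ?thesis .
qed

lemma mpow_scaleR: "mpow (r *\<^sub>R A) k = r ^ k *\<^sub>R mpow A k"
  by (induction k) (auto simp: matrix_scalar_ac scalar_matrix_assoc mult.commute)

lemma mexp_scaleR: "mexp s (r *\<^sub>R A) = mexp (s * r) A"
  unfolding mexp_def mpow_scaleR by (simp add: power_mult_distrib mult_ac)

lemma mexp_0 [simp]: "mexp 0 (A::real^'n^'n) = mat 1"
proof -
  have "(\<lambda>k. (0 ^ k / fact k) *\<^sub>R mpow A k) = (\<lambda>k. if k = 0 then mat 1 else 0)"
    by (auto simp: fun_eq_iff)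
  then show ?thesis
    unfolding mexp_def using sums_unique[OF sums_single[of 0 "\<lambda>_. mat 1 :: real^'n^'n"], symmetric]
    by simp
qed

lemma mphi_0 [simp]: "mphi 0 A = 0"
  unfolding mphi_def by simp

subsection \<open>The matrices \<open>J\<^sub>\<mu>\<close>\<close>

lemma inner_Jmat:
  fixes br :: "real^'n \<Rightarrow> real^'n \<Rightarrow> real^'m"
  assumes bil: "bilinear br"
  shows "(Jmat br \<mu> *v x) \<bullet> y = \<mu> \<bullet> br x y"
proof -
  have "\<mu> \<bullet> br x y = \<mu> \<bullet> br (\<Sum>j\<in>UNIV. x $ j *\<^sub>R axis j 1) (\<Sum>i\<in>UNIV. y $ i *\<^sub>R axis i 1)"
    using basis_expansion[of x] basis_expansion[of y] by (simp add: scalar_mult_eq_scaleR)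
  also have "\<dots> = (\<Sum>(j, i)\<in>UNIV \<times> UNIV. x $ j * y $ i * (\<mu> \<bullet> br (axis j 1) (axis i 1)))"
    unfolding bilinear_sum[OF bil] inner_sum_right
    by (intro sum.cong) (auto simp: bilinear_lmul[OF bil] bilinear_rmul[OF bil])
  also have "\<dots> = (\<Sum>j\<in>UNIV. \<Sum>i\<in>UNIV. x $ j * y $ i * (\<mu> \<bullet> br (axis j 1) (axis i 1)))"
    by (simp add: sum.cartesian_product)
  also have "\<dots> = (\<Sum>i\<in>UNIV. \<Sum>j\<in>UNIV. x $ j * y $ i * (\<mu> \<bullet> br (axis j 1) (axis i 1)))"
    by (rule sum.swap)
  also have "\<dots> = (Jmat br \<mu> *v x) \<bullet> y"
    unfolding inner_vec_def[of "Jmat br \<mu> *v x"]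
    by (simp add: matrix_vector_mult_def Jmat_def sum_distrib_left sum_distrib_right mult_ac)
  finally show ?thesis
    by simp
qed

lemma inner_Jmat_commute:
  assumes "bilinear br" and "\<And>x y. br x y = - br y x"
  shows "(Jmat br \<mu> *v x) \<bullet> y = - ((Jmat br \<mu> *v y) \<bullet> x)"
  using assms(2)[of x y] by (simp add: inner_Jmat[OF assms(1)])

lemma inner_Jmat_self:
  assumes "bilinear br" and "\<And>x y. br x y = - br y x"
  shows "(Jmat br \<mu> *v x) \<bullet> x = 0"
  using inner_Jmat_commute[OF assms, of \<mu> x x] by simp

lemma Jmat_add: "Jmat br (\<mu> + \<nu>) = Jmat br \<mu> + Jmat br \<nu>"
  by (simp add: Jmat_def vec_eq_iff inner_add_left)

lemma Jmat_scaleR: "Jmat br (r *\<^sub>R \<mu>) = r *\<^sub>R Jmat br \<mu>"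
  by (simp add: Jmat_def vec_eq_iff)

subsection \<open>Gradients and vector derivatives\<close>

lemma has_gradient_unique:
  assumes "has_gradient f a x" and "has_gradient f b x"
  shows "a = b"
proof -
  have "(\<lambda>h. a \<bullet> h) = (\<lambda>h. b \<bullet> h)"
    using assms unfolding has_gradient_def by (rule has_derivative_unique)
  then have "(a - b) \<bullet> (a - b) = 0"
    by (metis inner_diff_left right_minus_eq)
  then show ?thesis
    by simp
qed

lemma abs_not_has_real_derivative_0: "\<not> ((\<lambda>s::real. \<bar>s\<bar>) has_real_derivative D) (at 0)"
proof
  assume abs: "((\<lambda>s::real. \<bar>s\<bar>) has_real_derivative D) (at 0)"
  have "D = 0"
    by (rule DERIV_local_min[OF abs, of 1]) auto
  moreover have "((\<lambda>s::real. \<bar>s\<bar> - s) has_real_derivative D - 1) (at 0)"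
    using DERIV_diff[OF abs DERIV_ident] by simp
  then have "D - 1 = 0"
    by (rule DERIV_local_min[of _ _ _ 1]) auto
  ultimately show False
    by simp
qed

lemma has_derivative_half_sqnorm: "((\<lambda>z. (norm z)\<^sup>2 / 2) has_derivative (\<lambda>h. z \<bullet> h)) (at z)"
proof -
  have "((\<lambda>z. (norm z)\<^sup>2 / 2) has_derivative (\<lambda>h. (2 *\<^sub>R (z \<bullet> h)) / 2)) (at z)"
    by (intro derivative_eq_intros) auto
  then show ?thesis
    by simp
qed

lemma has_derivative_norm_inner:
  "z \<noteq> 0 \<Longrightarrow> (norm has_derivative (\<lambda>h. ((1 / norm z) *\<^sub>R z) \<bullet> h)) (at z)"
  using has_derivative_norm[of z] by (simp add: sgn_div_norm inner_commute divide_inverse_commute)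

lemma has_vector_derivative_oint:
  fixes f :: "real \<Rightarrow> 'a::euclidean_space"
  assumes "continuous_on UNIV f"
  shows "((\<lambda>s. oint s f) has_vector_derivative f t) (at t)"
proof -
  define a where "a = - \<bar>t\<bar> - 1"
  have a: "a < t" "a \<le> 0"
    by (auto simp: a_def)
  have integrable: "f integrable_on {p..q}" for p q
    using assms by (blast intro: integrable_continuous_real continuous_on_subset)
  have "((\<lambda>s. integral {a..s} f) has_vector_derivative f t) (at t within {a..\<bar>t\<bar> + 1})"
    using assms a by (intro integral_has_vector_derivative) (auto intro: continuous_on_subset)
  then have "((\<lambda>s. integral {a..s} f - integral {a..0} f) has_vector_derivative f t) (at t)"
    using at_within_Icc_at[of a t "\<bar>t\<bar> + 1"] a by (simp add: has_vector_derivative_diff_const)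
  then show ?thesis
  proof (rule has_vector_derivative_transform_within_open[of _ _ _ "{a<..}"])
    fix s
    assume "s \<in> {a<..}"
    then show "integral {a..s} f - integral {a..0} f = oint s f"
      using Henstock_Kurzweil_Integration.integral_combine[OF _ _ integrable, of a 0 s]
        Henstock_Kurzweil_Integration.integral_combine[OF _ _ integrable, of a s 0] a
      by (cases "0 \<le> s") (simp_all add: oint_def algebra_simps)
  qed (use a in auto)
qed

lemma eq_if_same_vector_derivative:
  fixes f g :: "real \<Rightarrow> 'a::real_normed_vector"
  assumes "\<And>t. (f has_vector_derivative D t) (at t)" and "\<And>t. (g has_vector_derivative D t) (at t)"
    and "f 0 = g 0"
  shows "f t = g t"
proof -
  have "((\<lambda>t. f t - g t) has_derivative (\<lambda>h. 0)) (at s)" for s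
    using has_vector_derivative_diff[OF assms(1,2)] by (simp add: has_vector_derivative_def)
  then have "f t - g t = f 0 - g 0"
    by (intro has_derivative_zero_unique[of UNIV]) auto
  then show ?thesis
    using assms(3) by simp
qed

lemma norm_eq_if_vector_derivative_orthogonal:
  fixes d :: "real \<Rightarrow> 'a::real_inner"
  assumes "\<And>t. (d has_vector_derivative d' t) (at t)" and "\<And>t. d t \<bullet> d' t = 0"
  shows "norm (d t) = norm (d 0)"
proof -
  have "((\<lambda>t. d t \<bullet> d t) has_vector_derivative 0) (at s)" for s
  proof -
    have "((\<lambda>t. d t \<bullet> d t) has_derivative (\<lambda>h. d s \<bullet> (h *\<^sub>R d' s) + (h *\<^sub>R d' s) \<bullet> d s)) (at s)"
      using assms(1)[of s] unfolding has_vector_derivative_def by (intro derivative_eq_intros) auto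
    then show ?thesis
      using assms(2)[of s] by (simp add: has_vector_derivative_def inner_commute)
  qed
  then have "d t \<bullet> d t = d 0 \<bullet> d 0"
    by (rule eq_if_same_vector_derivative) (auto intro: has_vector_derivative_const)
  then show ?thesis
    by (simp add: norm_eq_sqrt_inner)
qed

subsection \<open>Hamiltonians depending on the horizontal momentum\<close>

definition horizontal_momentum ::
  "(real^'n \<Rightarrow> real^'n \<Rightarrow> real^'m) \<Rightarrow> ((real^'n) \<times> (real^'m)) \<Rightarrow> ((real^'n) \<times> (real^'m)) \<Rightarrow> real^'n"
  where "horizontal_momentum br X \<Xi> = fst \<Xi> + (1/2) *\<^sub>R (Jmat br (snd \<Xi>) *v fst X)"

lemma Hsub_eq_norm_horizontal_momentum: "Hsub br X \<Xi> = norm (horizontal_momentum br X \<Xi>)"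
  by (simp add: Hsub_def horizontal_momentum_def)

lemma has_gradient_horizontal_momentum_covector:
  fixes br :: "real^'n \<Rightarrow> real^'n \<Rightarrow> real^'m"
  assumes bil: "bilinear br"
    and g: "(g has_derivative (\<lambda>h. w \<bullet> h)) (at (horizontal_momentum br X \<Xi>))"
  shows "has_gradient (\<lambda>\<eta>. g (horizontal_momentum br X \<eta>)) (w, (1/2) *\<^sub>R br (fst X) w) \<Xi>"
proof -
  have "bounded_linear (horizontal_momentum br X)"
    unfolding linear_conv_bounded_linear[symmetric]
    by (rule linearI) (auto simp: horizontal_momentum_def Jmat_add Jmat_scaleR
        matrix_vector_mult_add_rdistrib scaleR_matrix_vector_assoc[symmetric] algebra_simps)
  then have "(horizontal_momentum br X has_derivative horizontal_momentum br X) (at \<Xi>)"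
    by (rule bounded_linear_imp_has_derivative)
  from has_derivative_compose[OF this g]
  have "((\<lambda>\<eta>. g (horizontal_momentum br X \<eta>)) has_derivative
      (\<lambda>h. w \<bullet> horizontal_momentum br X h)) (at \<Xi>)" .
  moreover have "(\<lambda>h. w \<bullet> horizontal_momentum br X h) = (\<lambda>h. (w, (1/2) *\<^sub>R br (fst X) w) \<bullet> h)"
    by (auto simp: horizontal_momentum_def inner_prod_def inner_add_right inner_commute[of w]
        inner_commute[of "br (fst X) w"] inner_Jmat[OF bil])
  ultimately show ?thesis
    unfolding has_gradient_def by simp
qed

lemma has_gradient_horizontal_momentum_point:
  fixes br :: "real^'n \<Rightarrow> real^'n \<Rightarrow> real^'m"
  assumes bil: "bilinear br" and skew: "\<And>x y. br x y = - br y x"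
    and g: "(g has_derivative (\<lambda>h. w \<bullet> h)) (at (horizontal_momentum br X \<Xi>))"
  shows "has_gradient (\<lambda>y. g (horizontal_momentum br y \<Xi>)) (- ((1/2) *\<^sub>R (Jmat br (snd \<Xi>) *v w), 0)) X"
proof -
  define L where "L y = (1/2) *\<^sub>R (Jmat br (snd \<Xi>) *v fst y)" for y :: "(real^'n) \<times> (real^'m)"
  have "bounded_linear L"
    unfolding linear_conv_bounded_linear[symmetric]
    by (rule linearI) (auto simp: L_def matrix_vector_right_distrib algebra_simps)
  then have "((\<lambda>y. horizontal_momentum br y \<Xi>) has_derivative L) (at X)"
    unfolding horizontal_momentum_def L_def[symmetric]
    using bounded_linear_imp_has_derivative by (auto intro!: derivative_eq_intros)
  from has_derivative_compose[OF this g]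
  have "((\<lambda>y. g (horizontal_momentum br y \<Xi>)) has_derivative (\<lambda>h. w \<bullet> L h)) (at X)" .
  moreover have "(\<lambda>h. w \<bullet> L h) = (\<lambda>h. (- ((1/2) *\<^sub>R (Jmat br (snd \<Xi>) *v w), 0)) \<bullet> h)"
    by (auto simp: L_def inner_prod_def inner_commute[of w] inner_Jmat_commute[OF bil skew, of _ _ w])
  ultimately show ?thesis
    unfolding has_gradient_def by simp
qed

lemma hamiltonian_solution_horizontal_momentumI:
  fixes br :: "real^'n \<Rightarrow> real^'n \<Rightarrow> real^'m"
  assumes bil: "bilinear br" and skew: "\<And>x y. br x y = - br y x"
    and init: "X 0 = X0" "\<Xi> 0 = \<Xi>0"
    and g: "\<And>t. (g has_derivative (\<lambda>h. W t \<bullet> h)) (at (horizontal_momentum br (X t) (\<Xi> t)))"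
    and X: "\<And>t. (X has_vector_derivative (W t, (1/2) *\<^sub>R br (fst (X t)) (W t))) (at t)"
    and \<Xi>: "\<And>t. (\<Xi> has_vector_derivative ((1/2) *\<^sub>R (Jmat br (snd (\<Xi> t)) *v W t), 0)) (at t)"
  shows "hamiltonian_solution (\<lambda>X \<Xi>. g (horizontal_momentum br X \<Xi>)) X \<Xi> X0 \<Xi>0"
  unfolding hamiltonian_solution_def
  using init X \<Xi> has_gradient_horizontal_momentum_covector[OF bil g]
    has_gradient_horizontal_momentum_point[OF bil skew g]
  by blast

lemma hamiltonian_solution_horizontal_momentumD:
  fixes br :: "real^'n \<Rightarrow> real^'n \<Rightarrow> real^'m"
  assumes bil: "bilinear br" and skew: "\<And>x y. br x y = - br y x"
    and hs: "hamiltonian_solution (\<lambda>X \<Xi>. g (horizontal_momentum br X \<Xi>)) X \<Xi> X0 \<Xi>0"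
    and g: "(g has_derivative (\<lambda>h. W \<bullet> h)) (at (horizontal_momentum br (X t) (\<Xi> t)))"
  shows "(X has_vector_derivative (W, (1/2) *\<^sub>R br (fst (X t)) W)) (at t)"
    and "(\<Xi> has_vector_derivative ((1/2) *\<^sub>R (Jmat br (snd (\<Xi> t)) *v W), 0)) (at t)"
proof -
  obtain X' \<Xi>' where "(X has_vector_derivative X') (at t)" "(\<Xi> has_vector_derivative \<Xi>') (at t)"
    and "has_gradient (\<lambda>\<eta>. g (horizontal_momentum br (X t) \<eta>)) X' (\<Xi> t)"
    and "has_gradient (\<lambda>y. g (horizontal_momentum br y (\<Xi> t))) (- \<Xi>') (X t)"
    using hs unfolding hamiltonian_solution_def by blast
  moreover note has_gradient_horizontal_momentum_covector[OF bil g]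
    has_gradient_horizontal_momentum_point[OF bil skew g]
  ultimately show "(X has_vector_derivative (W, (1/2) *\<^sub>R br (fst (X t)) W)) (at t)"
    and "(\<Xi> has_vector_derivative ((1/2) *\<^sub>R (Jmat br (snd (\<Xi> t)) *v W), 0)) (at t)"
    using has_gradient_unique minus_equation_iff by metis+
qed

lemma hamiltonian_solution_horizontal_momentum_ode:
  fixes br :: "real^'n \<Rightarrow> real^'n \<Rightarrow> real^'m"
  assumes bil: "bilinear br" and skew: "\<And>x y. br x y = - br y x"
    and hs: "hamiltonian_solution (\<lambda>X \<Xi>. g (horizontal_momentum br X \<Xi>)) X \<Xi> X0 \<Xi>0"
    and g: "\<And>t. (g has_derivative (\<lambda>h. W t \<bullet> h)) (at (horizontal_momentum br (X t) (\<Xi> t)))"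
  shows "snd (\<Xi> t) = snd \<Xi>0"
    and "((\<lambda>t. fst (X t)) has_vector_derivative W t) (at t)"
    and "((\<lambda>t. snd (X t)) has_vector_derivative (1/2) *\<^sub>R br (fst (X t)) (W t)) (at t)"
    and "((\<lambda>t. horizontal_momentum br (X t) (\<Xi> t)) has_vector_derivative Jmat br (snd \<Xi>0) *v W t) (at t)"
proof -
  note X' = hamiltonian_solution_horizontal_momentumD(1)[OF bil skew hs g]
  note \<Xi>' = hamiltonian_solution_horizontal_momentumD(2)[OF bil skew hs g]
  have "((\<lambda>t. snd (\<Xi> t)) has_vector_derivative 0) (at t)" for t
    using bounded_linear.has_vector_derivative[OF bounded_linear_snd \<Xi>'] by simp
  from eq_if_same_vector_derivative[OF this has_vector_derivative_const refl]
  have \<mu>: "snd (\<Xi> s) = snd \<Xi>0" for s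
    using hs by (simp add: hamiltonian_solution_def)
  show "snd (\<Xi> t) = snd \<Xi>0"
    by (rule \<mu>)
  show x': "((\<lambda>t. fst (X t)) has_vector_derivative W t) (at t)" for t
    using bounded_linear.has_vector_derivative[OF bounded_linear_fst X'] by simp
  show "((\<lambda>t. snd (X t)) has_vector_derivative (1/2) *\<^sub>R br (fst (X t)) (W t)) (at t)"
    using bounded_linear.has_vector_derivative[OF bounded_linear_snd X'] by simp
  have "((\<lambda>s. fst (\<Xi> s) + (1/2) *\<^sub>R (Jmat br (snd \<Xi>0) *v fst (X s))) has_vector_derivative
      (1/2) *\<^sub>R (Jmat br (snd \<Xi>0) *v W t) + (1/2) *\<^sub>R (Jmat br (snd \<Xi>0) *v W t)) (at t)"
    using bounded_linear.has_vector_derivative[OF bounded_linear_fst \<Xi>'[where t = t]] \<mu>[of t]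
      bounded_linear.has_vector_derivative[OF bounded_linear_compose[OF bounded_linear_scaleR_right
          matrix_vector_mul_bounded_linear] x']
    by (intro has_vector_derivative_add) simp_all
  then show "((\<lambda>t. horizontal_momentum br (X t) (\<Xi> t)) has_vector_derivative Jmat br (snd \<Xi>0) *v W t) (at t)"
    using \<mu> by (simp add: horizontal_momentum_def scaleR_2[symmetric] del: scaleR_2)
qed

lemma not_has_gradient_norm_horizontal_momentum:
  fixes br :: "real^'n \<Rightarrow> real^'n \<Rightarrow> real^'m"
  assumes "horizontal_momentum br X \<Xi> = 0"
  shows "\<not> has_gradient (\<lambda>\<eta>. norm (horizontal_momentum br X \<eta>)) G \<Xi>"
proof
  assume grad: "has_gradient (\<lambda>\<eta>. norm (horizontal_momentum br X \<eta>)) G \<Xi>"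
  obtain e :: "real^'n" where e: "norm e = 1"
    using vector_choose_size[of 1] by auto
  define line where "line s = \<Xi> + s *\<^sub>R (e, 0)" for s :: real
  have "(line has_derivative (\<lambda>h. h *\<^sub>R (e, 0))) (at 0)"
    unfolding line_def by (auto intro!: derivative_eq_intros)
  moreover have "((\<lambda>\<eta>. norm (horizontal_momentum br X \<eta>)) has_derivative (\<lambda>h. G \<bullet> h)) (at (line 0))"
    using grad by (simp add: has_gradient_def line_def del: scaleR_Pair)
  ultimately have "((\<lambda>s. norm (horizontal_momentum br X (line s))) has_derivative
      (\<lambda>h. G \<bullet> (h *\<^sub>R (e, 0)))) (at 0)"
    by (rule has_derivative_compose)
  moreover have "horizontal_momentum br X (line s) = horizontal_momentum br X \<Xi> + s *\<^sub>R e" for s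
    by (simp add: line_def horizontal_momentum_def algebra_simps)
  then have "norm (horizontal_momentum br X (line s)) = \<bar>s\<bar>" for s
    using assms e by simp
  ultimately have "((\<lambda>s. \<bar>s\<bar>) has_real_derivative G \<bullet> (e, 0)) (at 0)"
    by (simp add: has_field_derivative_def mult_commute_abs del: scaleR_Pair)
  then show False
    using abs_not_has_real_derivative_0 by blast
qed

text \<open>For the Hamiltonian \<open>|v|\<close> differentiability along a solution forces \<open>v \<noteq> 0\<close>,
  and \<open>v' = J\<^sub>\<mu> v / |v|\<close> is orthogonal to \<open>v\<close>.\<close>

lemma norm_hamiltonian_solution_horizontal_momentum:
  fixes br :: "real^'n \<Rightarrow> real^'n \<Rightarrow> real^'m"
  assumes bil: "bilinear br" and skew: "\<And>x y. br x y = - br y x"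
    and hs: "hamiltonian_solution (\<lambda>X \<Xi>. norm (horizontal_momentum br X \<Xi>)) X \<Xi> X0 \<Xi>0"
  shows "horizontal_momentum br (X t) (\<Xi> t) \<noteq> 0"
    and "norm (horizontal_momentum br (X t) (\<Xi> t)) = norm (horizontal_momentum br X0 \<Xi>0)"
proof -
  show nonzero: "horizontal_momentum br (X t) (\<Xi> t) \<noteq> 0" for t
    using hs not_has_gradient_norm_horizontal_momentum
    unfolding hamiltonian_solution_def by (metis prod.collapse)
  note ode = hamiltonian_solution_horizontal_momentum_ode[OF bil skew hs has_derivative_norm_inner[OF nonzero]]
  have "norm (horizontal_momentum br (X t) (\<Xi> t)) = norm (horizontal_momentum br (X 0) (\<Xi> 0))"
    using ode(4) by (rule norm_eq_if_vector_derivative_orthogonal)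
      (simp add: matrix_vector_mult_scaleR inner_commute[of "horizontal_momentum br _ _"]
        inner_Jmat_self[OF bil skew])
  then show "norm (horizontal_momentum br (X t) (\<Xi> t)) = norm (horizontal_momentum br X0 \<Xi>0)"
    using hs by (simp add: hamiltonian_solution_def)
qed

subsection \<open>The explicit flow\<close>

locale momentum_flow =
  fixes br :: "real^'n \<Rightarrow> real^'n \<Rightarrow> real^'m" and \<mu>0 :: "real^'m" and \<xi>0 :: "real^'n" and c :: real
  assumes bil: "bilinear br" and skew: "\<And>x y. br x y = - br y x"
begin

text \<open>\<open>flow_v\<close> is the horizontal momentum along the flow and \<open>Jc = J\<^bsub>\<mu>0/c\<^esub> = J\<^bsub>\<mu>0\<^esub> / c\<close>;
  the other components are written exactly in the closed form of the statement.\<close>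

definition "Jc = Jmat br ((1/c) *\<^sub>R \<mu>0)"
definition "flow_v t = mexp t Jc *v \<xi>0"
definition "flow_x t = mphi (t / c) (Jmat br \<mu>0) *v \<xi>0"
definition "flow_u t = (1/2) *\<^sub>R oint t (\<lambda>\<tau>. br (flow_x \<tau>) (mexp \<tau> Jc *v ((1/c) *\<^sub>R \<xi>0)))"
definition "flow_\<xi> t = ((1/2) *\<^sub>R (mat 1 + mexp t Jc)) *v \<xi>0"
definition "flow_X t = (flow_x t, flow_u t)"
definition "flow_\<Xi> t = (flow_\<xi> t, \<mu>0)"

lemma mexp_Jc: "mexp (t / c) (Jmat br \<mu>0) = mexp t Jc"
  by (simp add: Jc_def Jmat_scaleR mexp_scaleR divide_inverse)

lemma has_vector_derivative_flow_v: "(flow_v has_vector_derivative Jc *v flow_v t) (at t)"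
  unfolding flow_v_def
  using bounded_linear.has_vector_derivative[OF bounded_linear_matrix_vector_mult_left has_vector_derivative_mexp]
  by (simp add: matrix_vector_mul_assoc)

lemma norm_flow_v: "norm (flow_v t) = norm \<xi>0"
proof -
  have "norm (flow_v t) = norm (flow_v 0)"
    using has_vector_derivative_flow_v
    by (rule norm_eq_if_vector_derivative_orthogonal)
      (simp add: Jc_def inner_commute[of "flow_v _"] inner_Jmat_self[OF bil skew])
  then show ?thesis
    by (simp add: flow_v_def)
qed

lemma has_vector_derivative_flow_x: "(flow_x has_vector_derivative (1/c) *\<^sub>R flow_v t) (at t)"
proof -
  have "((\<lambda>s. s / c) has_vector_derivative 1 / c) (at t)"
    unfolding has_real_derivative_iff_has_vector_derivative[symmetric] by (rule DERIV_cdivide[OF DERIV_ident])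
  moreover have "((\<lambda>s. mphi s (Jmat br \<mu>0) *v \<xi>0) has_vector_derivative
      mexp (t / c) (Jmat br \<mu>0) *v \<xi>0) (at (t / c))"
    by (rule bounded_linear.has_vector_derivative[OF bounded_linear_matrix_vector_mult_left
          has_vector_derivative_mphi])
  ultimately have "((\<lambda>s. mphi s (Jmat br \<mu>0) *v \<xi>0) \<circ> (\<lambda>s. s / c) has_vector_derivative
      (1 / c) *\<^sub>R (mexp (t / c) (Jmat br \<mu>0) *v \<xi>0)) (at t)"
    by (rule vector_diff_chain_at)
  then show ?thesis
    by (simp add: o_def flow_x_def[abs_def] flow_v_def mexp_Jc)
qed

lemma has_vector_derivative_flow_u:
  "(flow_u has_vector_derivative (1/2) *\<^sub>R br (flow_x t) ((1/c) *\<^sub>R flow_v t)) (at t)"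
proof -
  have integrand: "(\<lambda>\<tau>. br (flow_x \<tau>) (mexp \<tau> Jc *v ((1/c) *\<^sub>R \<xi>0)))
      = (\<lambda>\<tau>. br (flow_x \<tau>) ((1/c) *\<^sub>R flow_v \<tau>))"
    by (simp add: flow_v_def matrix_vector_mult_scaleR)
  have "continuous_on UNIV flow_x" "continuous_on UNIV flow_v"
    using has_vector_derivative_continuous has_vector_derivative_flow_x has_vector_derivative_flow_v
    by (blast intro: continuous_at_imp_continuous_on)+
  then have "continuous_on UNIV (\<lambda>\<tau>. br (flow_x \<tau>) ((1/c) *\<^sub>R flow_v \<tau>))"
    by (intro bounded_bilinear.continuous_on[OF bil[unfolded bilinear_conv_bounded_bilinear]]
        continuous_intros)
  from bounded_linear.has_vector_derivative[OF bounded_linear_scaleR_right has_vector_derivative_oint[OF this]]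
  show ?thesis
    unfolding flow_u_def integrand .
qed

lemma flow_\<xi>_eq: "flow_\<xi> t = (1/2) *\<^sub>R (\<xi>0 + flow_v t)"
  by (simp add: flow_\<xi>_def flow_v_def matrix_vector_mult_add_rdistrib scaleR_matrix_vector_assoc[symmetric])

lemma has_vector_derivative_flow_\<xi>:
  "(flow_\<xi> has_vector_derivative (1/2) *\<^sub>R (Jmat br \<mu>0 *v ((1/c) *\<^sub>R flow_v t))) (at t)"
proof -
  have "Jc *v flow_v t = Jmat br \<mu>0 *v ((1/c) *\<^sub>R flow_v t)"
    by (simp add: Jc_def Jmat_scaleR matrix_vector_mult_scaleR scaleR_matrix_vector_assoc[symmetric])
  then show ?thesis
    using bounded_linear.has_vector_derivative[OF bounded_linear_scaleR_right
        has_vector_derivative_add_const[THEN iffD2, OF has_vector_derivative_flow_v[of t]], of "1/2" \<xi>0]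
    by (simp add: flow_\<xi>_eq[abs_def] add.commute)
qed

lemma horizontal_momentum_flow: "horizontal_momentum br (flow_X t) (flow_\<Xi> t) = flow_v t"
proof -
  have "Jmat br \<mu>0 *v flow_x t = (mexp (t / c) (Jmat br \<mu>0) - mat 1) *v \<xi>0"
    by (simp add: flow_x_def matrix_vector_mul_assoc matrix_mult_mphi)
  then have "Jmat br \<mu>0 *v flow_x t = flow_v t - \<xi>0"
    by (simp add: mexp_Jc flow_v_def matrix_vector_mult_diff_rdistrib)
  then show ?thesis
    by (simp add: horizontal_momentum_def flow_X_def flow_\<Xi>_def flow_\<xi>_eq scaleR_add_right[symmetric])
qed

lemma flow_0: "flow_x 0 = 0" "flow_u 0 = 0" "flow_\<xi> 0 = \<xi>0" "flow_v 0 = \<xi>0"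
  by (simp_all add: flow_x_def flow_u_def flow_\<xi>_def flow_v_def oint_def
      matrix_vector_mult_add_rdistrib scaleR_matrix_vector_assoc[symmetric] scaleR_2[symmetric] del: scaleR_2)

lemma hamiltonian_solution_flow:
  assumes "\<And>t. (g has_derivative (\<lambda>h. ((1/c) *\<^sub>R flow_v t) \<bullet> h)) (at (flow_v t))"
  shows "hamiltonian_solution (\<lambda>X \<Xi>. g (horizontal_momentum br X \<Xi>)) flow_X flow_\<Xi> (0, 0) (\<xi>0, \<mu>0)"
  using assms flow_0
  by (intro hamiltonian_solution_horizontal_momentumI[OF bil skew, where W = "\<lambda>t. (1/c) *\<^sub>R flow_v t"])
    (simp_all add: flow_X_def[abs_def] flow_\<Xi>_def[abs_def]
      horizontal_momentum_flow[unfolded flow_X_def flow_\<Xi>_def] has_vector_derivative_Pair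
      has_vector_derivative_flow_x has_vector_derivative_flow_u has_vector_derivative_flow_\<xi>)

lemma hamiltonian_solution_eq_flow:
  assumes hs: "hamiltonian_solution (\<lambda>X \<Xi>. g (horizontal_momentum br X \<Xi>)) X \<Xi> (0, 0) (\<xi>0, \<mu>0)"
    and g: "\<And>t. (g has_derivative (\<lambda>h. ((1/c) *\<^sub>R horizontal_momentum br (X t) (\<Xi> t)) \<bullet> h))
      (at (horizontal_momentum br (X t) (\<Xi> t)))"
  shows "X = flow_X \<and> \<Xi> = flow_\<Xi>"
proof -
  define v where "v t = horizontal_momentum br (X t) (\<Xi> t)" for t
  have init: "X 0 = (0, 0)" "\<Xi> 0 = (\<xi>0, \<mu>0)"
    using hs by (simp_all add: hamiltonian_solution_def)
  note ode = hamiltonian_solution_horizontal_momentum_ode[OF bil skew hs g, folded v_def, simplified]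
  have v: "v t = flow_v t" for t
  proof -
    have "((\<lambda>t. v t - flow_v t) has_vector_derivative Jc *v (v t - flow_v t)) (at t)" for t
      using has_vector_derivative_diff[OF ode(4) has_vector_derivative_flow_v]
      by (simp add: Jc_def Jmat_scaleR matrix_vector_mult_scaleR scaleR_matrix_vector_assoc[symmetric]
          matrix_vector_mult_diff_distrib scaleR_diff_right)
    then have "norm (v t - flow_v t) = norm (v 0 - flow_v 0)"
      by (rule norm_eq_if_vector_derivative_orthogonal)
        (simp add: Jc_def inner_commute[of "v _ - flow_v _"] inner_Jmat_self[OF bil skew])
    then show ?thesis
      using init flow_0 by (simp add: v_def horizontal_momentum_def)
  qed
  have "((\<lambda>t. fst (X t)) has_vector_derivative (1/c) *\<^sub>R flow_v s) (at s)" for s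
    using ode(2)[of s] by (simp add: v)
  from eq_if_same_vector_derivative[OF this has_vector_derivative_flow_x]
  have x: "fst (X t) = flow_x t" for t
    using init flow_0 by simp
  have "((\<lambda>t. snd (X t)) has_vector_derivative (1/2) *\<^sub>R br (flow_x s) ((1/c) *\<^sub>R flow_v s)) (at s)" for s
    using ode(3)[of s] by (simp add: v x)
  from eq_if_same_vector_derivative[OF this has_vector_derivative_flow_u]
  have u: "snd (X t) = flow_u t" for t
    using init flow_0 by simp
  have "fst (\<Xi> t) = flow_\<xi> t" for t
    using v[of t] horizontal_momentum_flow[of t] x[of t] ode(1)[of t]
    by (simp add: v_def horizontal_momentum_def flow_X_def flow_\<Xi>_def) (metis add_right_cancel)
  then show ?thesis
    using x u ode(1) by (auto simp: fun_eq_iff prod_eq_iff flow_X_def flow_\<Xi>_def)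
qed

lemma unique_hamiltonian_solution_half_sqnorm:
  assumes "c = 1"
  shows "hamiltonian_solution (\<lambda>X \<Xi>. (Hsub br X \<Xi>)\<^sup>2 / 2) flow_X flow_\<Xi> (0, 0) (\<xi>0, \<mu>0) \<and>
    (\<forall>X \<Xi>. hamiltonian_solution (\<lambda>X \<Xi>. (Hsub br X \<Xi>)\<^sup>2 / 2) X \<Xi> (0, 0) (\<xi>0, \<mu>0)
      \<longrightarrow> X = flow_X \<and> \<Xi> = flow_\<Xi>)"
proof -
  have Hsub: "(\<lambda>X \<Xi>. (Hsub br X \<Xi>)\<^sup>2 / 2) = (\<lambda>X \<Xi>. (norm (horizontal_momentum br X \<Xi>))\<^sup>2 / 2)"
    by (simp add: Hsub_eq_norm_horizontal_momentum)
  have grad: "((\<lambda>z. (norm z)\<^sup>2 / 2) has_derivative (\<lambda>h. ((1/c) *\<^sub>R v) \<bullet> h)) (at v)" for v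
    using has_derivative_half_sqnorm[of v] assms by simp
  have "hamiltonian_solution (\<lambda>X \<Xi>. (Hsub br X \<Xi>)\<^sup>2 / 2) flow_X flow_\<Xi> (0, 0) (\<xi>0, \<mu>0)"
    unfolding Hsub by (rule hamiltonian_solution_flow[where g = "\<lambda>z. (norm z)\<^sup>2 / 2", OF grad])
  moreover have "X = flow_X \<and> \<Xi> = flow_\<Xi>"
    if "hamiltonian_solution (\<lambda>X \<Xi>. (Hsub br X \<Xi>)\<^sup>2 / 2) X \<Xi> (0, 0) (\<xi>0, \<mu>0)" for X \<Xi>
    using that unfolding Hsub
    by (rule hamiltonian_solution_eq_flow[where g = "\<lambda>z. (norm z)\<^sup>2 / 2", OF _ grad])
  ultimately show ?thesis
    by blast
qed

lemma unique_hamiltonian_solution_norm: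
  assumes "c = norm \<xi>0" and "\<xi>0 \<noteq> 0"
  shows "hamiltonian_solution (Hsub br) flow_X flow_\<Xi> (0, 0) (\<xi>0, \<mu>0) \<and>
    (\<forall>X \<Xi>. hamiltonian_solution (Hsub br) X \<Xi> (0, 0) (\<xi>0, \<mu>0) \<longrightarrow> X = flow_X \<and> \<Xi> = flow_\<Xi>)"
proof -
  have Hsub: "Hsub br = (\<lambda>X \<Xi>. norm (horizontal_momentum br X \<Xi>))"
    by (simp add: fun_eq_iff Hsub_eq_norm_horizontal_momentum)
  have grad: "(norm has_derivative (\<lambda>h. ((1/c) *\<^sub>R v) \<bullet> h)) (at v)" if "norm v = norm \<xi>0" for v
  proof -
    have "v \<noteq> 0"
      using that assms(2) by auto
    then show ?thesis
      using has_derivative_norm_inner[of v] that assms(1) by simp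
  qed
  have "hamiltonian_solution (Hsub br) flow_X flow_\<Xi> (0, 0) (\<xi>0, \<mu>0)"
    unfolding Hsub by (rule hamiltonian_solution_flow[where g = norm]) (rule grad[OF norm_flow_v])
  moreover have "X = flow_X \<and> \<Xi> = flow_\<Xi>" if "hamiltonian_solution (Hsub br) X \<Xi> (0, 0) (\<xi>0, \<mu>0)" for X \<Xi>
  proof (rule hamiltonian_solution_eq_flow[where g = norm])
    show hs: "hamiltonian_solution (\<lambda>X \<Xi>. norm (horizontal_momentum br X \<Xi>)) X \<Xi> (0, 0) (\<xi>0, \<mu>0)"
      using that by (simp add: Hsub)
    show "(norm has_derivative (\<lambda>h. ((1/c) *\<^sub>R horizontal_momentum br (X t) (\<Xi> t)) \<bullet> h))
        (at (horizontal_momentum br (X t) (\<Xi> t)))" for t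
      using norm_hamiltonian_solution_horizontal_momentum(2)[OF bil skew hs]
      by (intro grad) (simp add: horizontal_momentum_def)
  qed
  ultimately show ?thesis
    by blast
qed

end

theorem proposition5p1:
  fixes br :: "real^'n \<Rightarrow> real^'n \<Rightarrow> real^'m"
    and \<xi>0 :: "real^'n" and \<mu>0 :: "real^'m"
  assumes bil: "bilinear br"
    and skew: "\<And>x y. br x y = - br y x"
    and strat: "span {br x y | x y. True} = UNIV"
  defines "J \<equiv> Jmat br"
  defines "Xa \<equiv> (\<lambda>t. (mphi t (J \<mu>0) *v \<xi>0,
              (1/2) *\<^sub>R oint t (\<lambda>\<tau>. br (mphi \<tau> (J \<mu>0) *v \<xi>0) (mexp \<tau> (J \<mu>0) *v \<xi>0))))"
    and "\<Xi>a \<equiv> (\<lambda>t. (((1/2) *\<^sub>R (mat 1 + mexp t (J \<mu>0))) *v \<xi>0, \<mu>0))"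
    and "Xb \<equiv> (\<lambda>t. (mphi (t / norm \<xi>0) (J \<mu>0) *v \<xi>0,
              (1/2) *\<^sub>R oint t (\<lambda>\<tau>. br (mphi (\<tau> / norm \<xi>0) (J \<mu>0) *v \<xi>0)
                   (mexp \<tau> (J ((1 / norm \<xi>0) *\<^sub>R \<mu>0)) *v ((1 / norm \<xi>0) *\<^sub>R \<xi>0)))))"
    and "\<Xi>b \<equiv> (\<lambda>t. (((1/2) *\<^sub>R (mat 1 + mexp t (J ((1 / norm \<xi>0) *\<^sub>R \<mu>0)))) *v \<xi>0, \<mu>0))"
  shows "(hamiltonian_solution (\<lambda>X \<Xi>. (Hsub br X \<Xi>)\<^sup>2 / 2) Xa \<Xi>a (0, 0) (\<xi>0, \<mu>0) \<and>
          (\<forall>X \<Xi>. hamiltonian_solution (\<lambda>X \<Xi>. (Hsub br X \<Xi>)\<^sup>2 / 2) X \<Xi> (0, 0) (\<xi>0, \<mu>0)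
                 \<longrightarrow> X = Xa \<and> \<Xi> = \<Xi>a))
       \<and> (\<xi>0 \<noteq> 0 \<longrightarrow>
          hamiltonian_solution (Hsub br) Xb \<Xi>b (0, 0) (\<xi>0, \<mu>0) \<and>
          (\<forall>X \<Xi>. hamiltonian_solution (Hsub br) X \<Xi> (0, 0) (\<xi>0, \<mu>0)
                 \<longrightarrow> X = Xb \<and> \<Xi> = \<Xi>b))"
proof -
  interpret unit: momentum_flow br \<mu>0 \<xi>0 1
    by unfold_locales (rule bil, rule skew)
  interpret normed: momentum_flow br \<mu>0 \<xi>0 "norm \<xi>0"
    by unfold_locales (rule bil, rule skew)
  have Xa: "Xa = unit.flow_X"
    by (simp add: fun_eq_iff Xa_def J_def unit.flow_X_def unit.flow_x_def unit.flow_u_def unit.Jc_def)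
  have \<Xi>a: "\<Xi>a = unit.flow_\<Xi>"
    by (simp add: fun_eq_iff \<Xi>a_def J_def unit.flow_\<Xi>_def unit.flow_\<xi>_def unit.Jc_def)
  have Xb: "Xb = normed.flow_X"
    by (simp add: fun_eq_iff Xb_def J_def normed.flow_X_def normed.flow_x_def normed.flow_u_def normed.Jc_def)
  have \<Xi>b: "\<Xi>b = normed.flow_\<Xi>"
    by (simp add: fun_eq_iff \<Xi>b_def J_def normed.flow_\<Xi>_def normed.flow_\<xi>_def normed.Jc_def)
  show ?thesis
    unfolding Xa \<Xi>a Xb \<Xi>b
    using unit.unique_hamiltonian_solution_half_sqnorm[OF refl]
      impI[OF normed.unique_hamiltonian_solution_norm[OF refl]]
    by (rule conjI)
qed

end
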